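(* Let $\kappa\leq\lambda$ be infinite cardinals with $\kappa$ regular. Let $\delta=\lambda^{<\kappa}$ (which is the weight of ${}^{\kappa}\lambda$), and assume $\delta>\lambda$. Then there is no continuous weak $\delta^+$-measure space $({}^{\kappa}\lambda,\mathfrak{M},\mu)$ on ${}^{\kappa}\lambda$ (for any choice of positively totally ordered monoid $\mathbb{S}$ with infinitary sum $\mathsf{Sum}$ in which $\mu$ takes its values).
   Context: **Topology.** ${}^{\kappa}\lambda$ is the set of sequences of elements of $\lambda$ of length $\kappa$, with the bounded topology, generated by the cones $\mathbf{N}_s=\{x\in{}^{\kappa}\lambda\mid s\subseteq x\}$ for $s\in{}^{<\kappa}\lambda=\bigcup_{\alpha<\kappa}{}^{\alpha}\lambda$. **Monoids and sums.** A positively totally ordered monoid is $\mathbb{S}=(S,0,+,\leq)$ where $+$ is associative (not necessarily commutative) with neutral element $0$, $\leq$ is a total order, $a\leq b$ and $c\leq d$ imply $a+c\leq b+d$, $0$ is the minimum of $\leq$, and $S\neq\{0\}$. ${}^{<\mathrm{On}}\mathbb{S}$ is the class of all sequences of elements of $S$ of ordinal length; $\mathrm{lh}(s)$ is the length of $s$. An infinitary sum on $\mathbb{S}$ is a partial function $\mathsf{Sum}:{}^{<\mathrm{On}}\mathbb{S}\to\mathbb{S}$ such that: (S1) $\mathsf{Sum}(\emptyset)=0$ and $\mathsf{Sum}(s)=s_0+\dots+s_n$ for every non-empty finite $s=(s_i)_{i\leq n}\in\mathrm{dom}(\mathsf{Sum})$; (S2) (continuity) for all $s\in\mathrm{dom}(\mathsf{Sum})$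 of limit length, if $s\restriction\alpha\in\mathrm{dom}(\mathsf{Sum})$ for cofinally many $\alpha<\mathrm{lh}(s)$, then $\mathsf{Sum}(s)=\sup\{\mathsf{Sum}(s\restriction\alpha)\mid\alpha<\mathrm{lh}(s),\ s\restriction\alpha\in\mathrm{dom}(\mathsf{Sum})\}$. **Measures.** For an infinite cardinal $\delta$, a weakly $\delta^+$-measurable space is a pair $(X,\mathfrak{M})$ where $X$ is a topological space and $\mathfrak{M}$ is a family of subsets of $X$ closed under unions of size $\leq\delta$ and containing all open subsets of $X$. A $\delta^+$-measure on it (with values in $(\mathbb{S},\mathsf{Sum})$) is a partial function $\mu:\mathscr{P}(X)\to\mathbb{S}$ with $\mathfrak{M}\subseteq\mathrm{dom}(\mu)$ such that: (M1) $\mu(\emptyset)=0$; (M2) $\mu(X)>0$; (M3) $A\subseteq B$ implies $\mu(A)\leq\mu(B)$ for all $A,B\in\mathfrak{M}$; (M4) for every family $(A_i)_{i<\gamma}$ of pairwise disjoint sets of $\mathfrak{M}$ of length an ordinal $\gamma<\delta^+$, we have $\langle\mu(A_i)\mid i<\gamma\rangle\in\mathrm{dom}(\mathsf{Sum})$ and $\mu(\bigcup_{i<\gamma}A_i)=\mathsf{Sum}(\langle\mu(A_i)\mid i<\gamma\rangle)$; (M5) for every $x\in X$ with $\{x\}\in\mathfrak{M}$ and every open local basis $\{A_i\mid i<\gamma\}$ at $x$ with $\gamma<\delta^+$, $\mu(\{x\})=\inf_{i<\gamma}\mu(A_i)$. Then $(X,\mathfrak{M},\mu)$ is called a weak $\delta^+$-measure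 space. It is continuous if $\{x\}\in\mathfrak{M}$ and $\mu(\{x\})=0$ for every $x\in X$. *)

theory Defs
  imports "HOL-Analysis.Analysis" "HOL-Library.Lub_Glb"
begin

unbundle cardinal_syntax

text \<open>
  Cardinals and ordinals are well-order relations, as in the library. An element \<open>\<alpha>\<close> of
  \<open>Field r\<close> stands for the ordinal that is the order type of \<open>underS r \<alpha>\<close>, and a sequence of
  length \<open>\<alpha>\<close> is a partial map with domain \<open>underS r \<alpha>\<close>. Hence \<open>s \<subseteq> x\<close> is \<open>s \<subseteq>\<^sub>m x\<close>, and the
  restriction of \<open>s\<close> to \<open>\<alpha>\<close> is \<open>s |` underS r \<alpha>\<close>.
\<close>

definition seqs_below :: "'i rel \<Rightarrow> 'a set \<Rightarrow> ('i \<rightharpoonup> 'a) set" where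
  "seqs_below r A = {s. (\<exists>\<alpha> \<in> Field r. dom s = underS r \<alpha>) \<and> ran s \<subseteq> A}"

definition full_seqs :: "'i rel \<Rightarrow> 'a set \<Rightarrow> ('i \<rightharpoonup> 'a) set" where
  "full_seqs r A = {x. dom x = Field r \<and> ran x \<subseteq> A}"

definition cone :: "'i rel \<Rightarrow> 'a set \<Rightarrow> ('i \<rightharpoonup> 'a) \<Rightarrow> ('i \<rightharpoonup> 'a) set" where
  "cone r A s = {x \<in> full_seqs r A. s \<subseteq>\<^sub>m x}"

definition bounded_topology :: "'i rel \<Rightarrow> 'a set \<Rightarrow> ('i \<rightharpoonup> 'a) topology" where
  "bounded_topology r A = topology_generated_by (cone r A ` seqs_below r A)"

class pos_tot_ordered_monoid = monoid_add + linorder +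
  assumes plus_mono: "a \<le> b \<Longrightarrow> c \<le> d \<Longrightarrow> a + c \<le> b + d"
    and zero_minimum: "0 \<le> a"
    and nontrivial: "\<exists>a. a \<noteq> 0"

text \<open>
  The well-order \<open>\<Omega>\<close> plays the role of the class of all ordinals: a sum is defined on (some)
  sequences whose length is an ordinal below the order type of \<open>\<Omega>\<close>.
\<close>

locale infinitary_sum =
  fixes \<Omega> :: "'o rel"
    and Sum :: "('o \<rightharpoonup> 's::pos_tot_ordered_monoid) \<rightharpoonup> 's"
  assumes well_order: "Well_order \<Omega>"
    and dom_Sum: "dom Sum \<subseteq> seqs_below \<Omega> UNIV"
    and S1_empty: "Sum Map.empty = Some 0"
    \<comment> \<open>\<open>is\<close> lists the finitely many indices of \<open>s\<close> in increasing order\<close>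
    and S1_finite: "\<And>s is. s \<in> dom Sum \<Longrightarrow> is \<noteq> [] \<Longrightarrow> set is = dom s \<Longrightarrow>
      sorted_wrt (\<lambda>i j. i \<noteq> j \<and> (i, j) \<in> \<Omega>) is \<Longrightarrow>
      Sum s = Some (sum_list (map (\<lambda>i. the (s i)) is))"
    \<comment> \<open>\<open>dom s\<close> is the set of all \<open>\<alpha> < lh s\<close>; the length of \<open>s\<close> is a limit iff \<open>dom s\<close> is non-empty
      and has no largest element\<close>
    and S2: "\<And>s. s \<in> dom Sum \<Longrightarrow> dom s \<noteq> {} \<Longrightarrow>
      (\<forall>\<alpha> \<in> dom s. \<exists>\<beta> \<in> dom s. \<alpha> \<noteq> \<beta> \<and> (\<alpha>, \<beta>) \<in> \<Omega>) \<Longrightarrow>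
      (\<forall>\<alpha> \<in> dom s. \<exists>\<beta> \<in> dom s. (\<alpha>, \<beta>) \<in> \<Omega> \<and> s |` underS \<Omega> \<beta> \<in> dom Sum) \<Longrightarrow>
      isLub UNIV {the (Sum (s |` underS \<Omega> \<alpha>)) |\<alpha>. \<alpha> \<in> dom s \<and> s |` underS \<Omega> \<alpha> \<in> dom Sum}
        (the (Sum s))"

text \<open>The ordinals \<open>\<gamma> < \<delta>\<^sup>+\<close>; they are all represented in \<open>\<Omega>\<close> as soon as \<open>cardSuc \<delta> \<le>o \<Omega>\<close>.\<close>

definition ords_below_cardSuc :: "'o rel \<Rightarrow> 'd rel \<Rightarrow> 'o set" where
  "ords_below_cardSuc \<Omega> \<delta> = {\<gamma> \<in> Field \<Omega>. Restr \<Omega> (underS \<Omega> \<gamma>) <o cardSuc \<delta>}"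

definition open_local_basis :: "'x topology \<Rightarrow> 'x \<Rightarrow> 'x set set \<Rightarrow> bool" where
  "open_local_basis X x \<B> \<longleftrightarrow> (\<forall>V \<in> \<B>. openin X V \<and> x \<in> V) \<and>
     (\<forall>U. openin X U \<and> x \<in> U \<longrightarrow> (\<exists>V \<in> \<B>. V \<subseteq> U))"

locale weakly_measurable_space =
  fixes \<delta> :: "'d rel" and X :: "'x topology" and M :: "'x set set"
  assumes infinite_card: "Cinfinite \<delta>"
    and subsets: "M \<subseteq> Pow (topspace X)"
    and Union_closed: "\<And>F. F \<subseteq> M \<Longrightarrow> |F| \<le>o \<delta> \<Longrightarrow> \<Union>F \<in> M"
    and open_sets: "\<And>U. openin X U \<Longrightarrow> U \<in> M"

locale weak_measure_space =
  weakly_measurable_space \<delta> X M + infinitary_sum \<Omega> Sum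
  for \<delta> :: "'d rel" and \<Omega> :: "'o rel"
    and Sum :: "('o \<rightharpoonup> 's::pos_tot_ordered_monoid) \<rightharpoonup> 's"
    and X :: "'x topology" and M :: "'x set set" +
  fixes \<mu> :: "'x set \<rightharpoonup> 's"
  assumes long: "cardSuc \<delta> \<le>o \<Omega>"
    and dom_subsets: "dom \<mu> \<subseteq> Pow (topspace X)"
    and measurable_dom: "M \<subseteq> dom \<mu>"
    and M1: "\<mu> {} = Some 0"
    and M2: "the (\<mu> (topspace X)) > 0"
    and M3: "\<And>A B. A \<in> M \<Longrightarrow> B \<in> M \<Longrightarrow> A \<subseteq> B \<Longrightarrow> the (\<mu> A) \<le> the (\<mu> B)"
    and M4: "\<And>\<gamma> A. \<gamma> \<in> ords_below_cardSuc \<Omega> \<delta> \<Longrightarrow> (\<forall>i \<in> underS \<Omega> \<gamma>. A i \<in> M) \<Longrightarrow>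
      disjoint_family_on A (underS \<Omega> \<gamma>) \<Longrightarrow>
      (\<lambda>i. \<mu> (A i)) |` underS \<Omega> \<gamma> \<in> dom Sum \<and>
      \<mu> (\<Union>i \<in> underS \<Omega> \<gamma>. A i) = Sum ((\<lambda>i. \<mu> (A i)) |` underS \<Omega> \<gamma>)"
    and M5: "\<And>x \<gamma> A. x \<in> topspace X \<Longrightarrow> {x} \<in> M \<Longrightarrow> \<gamma> \<in> ords_below_cardSuc \<Omega> \<delta> \<Longrightarrow>
      open_local_basis X x (A ` underS \<Omega> \<gamma>) \<Longrightarrow>
      isGlb UNIV ((\<lambda>i. the (\<mu> (A i))) ` underS \<Omega> \<gamma>) (the (\<mu> {x}))"

definition continuous_measure ::
    "'x topology \<Rightarrow> 'x set set \<Rightarrow> ('x set \<rightharpoonup> 's::pos_tot_ordered_monoid) \<Rightarrow> bool" where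
  "continuous_measure X M \<mu> \<longleftrightarrow> (\<forall>x \<in> topspace X. {x} \<in> M \<and> \<mu> {x} = Some 0)"

end

theory Submission
  imports Defs
begin

text \<open>
  Since \<open>\<delta> > \<lambda>\<close>, the regular cardinal \<open>\<kappa>\<close> is uncountable. If \<open>\<mu>\<close> is a continuous measure, some point
  \<open>x\<close> has only neighbourhoods of positive measure (otherwise the space is a disjoint union of null
  cones), and their measures have infimum \<open>0\<close>. Hence there are \<open>a\<^sub>0 < a\<^sub>1 < \<dots>\<close> below \<open>\<kappa>\<close> such that
  \<open>N(x|a\<^sub>0)\<close> is smaller than the whole space and all \<open>A\<^sub>n = N(x|a\<^sub>n) - N(x|a\<^sub>n\<^sub>+\<^sub>1)\<close> have positive
  measure; as \<open>\<kappa>\<close> is regular and uncountable, a single \<open>\<epsilon> > 0\<close> lies below all \<open>\<mu>(A\<^sub>n)\<close>.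
  Continuity of the sum at \<open>\<omega>\<close> then shows that \<open>A = \<Union>A\<^sub>n\<close> absorbs every disjoint set of measure at
  most \<open>\<epsilon>\<close>. The complement of \<open>A\<close> is a disjoint union of at most \<open>\<delta>\<close> cones of measure at most
  \<open>\<epsilon>\<close>, so the whole space has measure \<open>\<mu>(A) \<le> \<mu>(N(x|a\<^sub>0))\<close>, a contradiction.
\<close>

section \<open>Measures of well-ordered unions\<close>

context weak_measure_space
begin

abbreviation \<nu> :: "'x set \<Rightarrow> 's" where
  "\<nu> A \<equiv> the (\<mu> A)"

section \<open>Initial segments of \<open>\<Omega>\<close> as index sets\<close>

lemma Card_order_delta: "Card_order \<delta>"
  using infinite_card by simp

lemma Field_Restr_underS: "Field (Restr \<Omega> (underS \<Omega> \<gamma>)) = underS \<Omega> \<gamma>"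
  using well_order by (simp add: Field_Restr_ofilter wo_rel.underS_ofilter wo_rel_def)

lemma Omega_trans: "(a, b) \<in> \<Omega> \<Longrightarrow> (b, c) \<in> \<Omega> \<Longrightarrow> (a, c) \<in> \<Omega>"
  using well_order by (meson order_on_defs transD)

lemma Omega_antisym: "(a, b) \<in> \<Omega> \<Longrightarrow> (b, a) \<in> \<Omega> \<Longrightarrow> a = b"
  using well_order by (meson order_on_defs antisymD)

lemma underS_underS_subset: "b \<in> underS \<Omega> a \<Longrightarrow> underS \<Omega> b \<subseteq> underS \<Omega> a"
  unfolding underS_def using Omega_trans Omega_antisym by blast

lemma ords_below_downward:
  assumes "\<gamma> \<in> ords_below_cardSuc \<Omega> \<delta>" and "\<alpha> \<in> underS \<Omega> \<gamma>"
  shows "\<alpha> \<in> ords_below_cardSuc \<Omega> \<delta>"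
proof -
  have "Restr \<Omega> (underS \<Omega> \<alpha>) \<le>o Restr \<Omega> (underS \<Omega> \<gamma>)"
    using ofilter_subset_ordLeq[OF well_order] underS_underS_subset[OF assms(2)] well_order
    by (simp add: wo_rel.underS_ofilter wo_rel_def)
  moreover have "\<alpha> \<in> Field \<Omega>"
    using assms(2) by (auto simp: underS_def Field_def)
  ultimately show ?thesis
    using assms(1) ordLeq_ordLess_trans by (auto simp: ords_below_cardSuc_def)
qed

text \<open>\<open>M4\<close> and \<open>M5\<close> only accept index sets
  \<open>underS \<Omega> \<gamma>\<close>; this lets any well-order of length at most
  \<open>\<delta>\<close> serve instead. Since \<open>cardSuc \<delta> \<le>o \<Omega>\<close>, such
  an order is isomorphic to a proper initial segment of \<open>\<Omega>\<close>. The last conclusion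
  carries partial unions across the isomorphism.\<close>

lemma ord_representation:
  assumes r: "Well_order r" and le: "r \<le>o \<delta>"
  obtains \<gamma> f where "\<gamma> \<in> ords_below_cardSuc \<Omega> \<delta>"
    and "bij_betw f (Field r) (underS \<Omega> \<gamma>)"
    and "\<And>a. a \<in> Field r \<Longrightarrow> f ` underS r a = underS \<Omega> (f a)"
proof -
  have lt: "r <o cardSuc \<delta>"
    using le cardSuc_greater[OF Card_order_delta] ordLeq_ordLess_trans by blast
  then have "r <o \<Omega>"
    using long ordLess_ordLeq_trans by blast
  then obtain \<gamma> where \<gamma>: "\<gamma> \<in> Field \<Omega>" and iso: "r =o Restr \<Omega> (underS \<Omega> \<gamma>)"
    using ordLess_iff_ordIso_Restr[OF well_order r] by blast
  then obtain f where f: "iso r (Restr \<Omega> (underS \<Omega> \<gamma>)) f"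
    by (auto simp: ordIso_def)
  have b: "bij_betw f (Field r) (underS \<Omega> \<gamma>)"
    using f by (simp add: iso_iff2 Field_Restr_underS)
  have u: "f ` underS r a = underS \<Omega> (f a)" if a: "a \<in> Field r" for a
  proof -
    have "bij_betw f (underS r a) (underS (Restr \<Omega> (underS \<Omega> \<gamma>)) (f a))"
      using embed_underS[OF r _ a] f by (auto simp: iso_def)
    moreover have "f a \<in> underS \<Omega> \<gamma>"
      using b a by (auto simp: bij_betw_def)
    then have "underS (Restr \<Omega> (underS \<Omega> \<gamma>)) (f a) = underS \<Omega> (f a)"
      using underS_underS_subset[of "f a" \<gamma>] by (auto simp: underS_def)
    ultimately show ?thesis by (simp add: bij_betw_def)
  qed
  have "\<gamma> \<in> ords_below_cardSuc \<Omega> \<delta>"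
    using \<gamma> ordIso_ordLess_trans[OF ordIso_symmetric[OF iso] lt]
    by (simp add: ords_below_cardSuc_def)
  then show thesis using that b u by blast
qed

section \<open>Measurability of small unions and finite additivity\<close>

lemma measurable_UN: "|I| \<le>o \<delta> \<Longrightarrow> (\<And>i. i \<in> I \<Longrightarrow> A i \<in> M) \<Longrightarrow> (\<Union>i\<in>I. A i) \<in> M"
  by (rule Union_closed) (auto intro: ordLeq_transitive[OF card_of_image])

lemma finite_ordLeq_delta:
  assumes "finite I"
  shows "|I| \<le>o \<delta>"
proof -
  have "\<not> finite (Field \<delta>)"
    using infinite_card by (simp add: cinfinite_def)
  moreover have "Well_order \<delta>"
    using Card_order_delta by (rule card_order_on_well_order_on)
  ultimately have "|I| <o \<delta>"
    using assms finite_ordLess_infinite[OF card_of_Well_order] by (metis Field_card_of)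
  then show ?thesis by (rule ordLess_imp_ordLeq)
qed

lemma measurable_Un: "A \<in> M \<Longrightarrow> B \<in> M \<Longrightarrow> A \<union> B \<in> M"
  using Union_closed[of "{A, B}"] finite_ordLeq_delta[of "{A, B}"] by simp

lemma empty_measurable: "{} \<in> M"
  using open_sets by simp

text \<open>This is \<open>M4\<close> for a sequence of length 2, whose sum \<open>S1_finite\<close>
  evaluates.\<close>

lemma nu_Un:
  assumes A: "A \<in> M" and B: "B \<in> M" and disj: "A \<inter> B = {}"
  shows "\<nu> (A \<union> B) = \<nu> A + \<nu> B"
proof -
  let ?r = "natLeq_on 2"
  have r: "Well_order ?r" by (rule natLeq_on_Well_order)
  have F: "Field ?r = {0, 1}" by (auto simp: Field_natLeq_on)
  have "?r <o \<delta>"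
  proof (rule finite_ordLess_infinite[OF r])
    show "Well_order \<delta>" using Card_order_delta by (rule card_order_on_well_order_on)
    show "finite (Field ?r)" unfolding F by simp
    show "\<not> finite (Field \<delta>)" using infinite_card by (simp add: cinfinite_def)
  qed
  then have le: "?r \<le>o \<delta>" by (rule ordLess_imp_ordLeq)
  obtain \<gamma> f where \<gamma>: "\<gamma> \<in> ords_below_cardSuc \<Omega> \<delta>"
    and b: "bij_betw f {0, 1} (underS \<Omega> \<gamma>)"
    and u: "\<And>a. a \<in> {0, 1} \<Longrightarrow> f ` underS ?r a = underS \<Omega> (f a)"
    by (rule ord_representation[OF r le]) (simp only: F)
  let ?i = "f 0" and ?j = "f 1"
  have U: "underS \<Omega> \<gamma> = {?i, ?j}" and ne: "?i \<noteq> ?j"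
    using b by (auto simp: bij_betw_def)
  \<comment> \<open>The order of the two indices matters: it makes \<open>\<nu> A\<close> the left
    summand in a possibly non-commutative monoid.\<close>
  have "0 \<in> underS ?r 1" by (auto simp: underS_def)
  then have lt: "(?i, ?j) \<in> \<Omega>"
    using u[of 1] unfolding underS_def by blast
  define C where "C = (\<lambda>i. if i = ?i then A else B)"
  let ?s = "(\<lambda>i. \<mu> (C i)) |` underS \<Omega> \<gamma>"
  have CM: "\<forall>i \<in> underS \<Omega> \<gamma>. C i \<in> M" using A B by (simp add: C_def)
  have Cd: "disjoint_family_on C (underS \<Omega> \<gamma>)"
    using disj by (auto simp: C_def U disjoint_family_on_def)
  have sum: "?s \<in> dom Sum" "\<mu> (\<Union>i \<in> underS \<Omega> \<gamma>. C i) = Sum ?s"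
    using M4[OF \<gamma> CM Cd] by auto
  have dom: "dom ?s = {?i, ?j}"
    using measurable_dom CM by (auto simp: U restrict_map_def split: if_splits)
  have "Sum ?s = Some (sum_list (map (\<lambda>i. the (?s i)) [?i, ?j]))"
    by (rule S1_finite) (use sum dom ne lt in auto)
  also have "\<dots> = Some (\<nu> A + \<nu> B)"
    using ne by (auto simp: U C_def)
  finally have "Sum ?s = Some (\<nu> A + \<nu> B)" .
  moreover have "(\<Union>i \<in> underS \<Omega> \<gamma>. C i) = A \<union> B"
    using ne by (auto simp: U C_def)
  ultimately show ?thesis
    using sum(2) by simp
qed

section \<open>Bounds on unions by transfinite induction\<close>

lemma nu_limit_le:
  assumes \<gamma>: "\<gamma> \<in> ords_below_cardSuc \<Omega> \<delta>" and A: "\<And>i. i \<in> underS \<Omega> \<gamma> \<Longrightarrow> A i \<in> M"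
    and disj: "disjoint_family_on A (underS \<Omega> \<gamma>)" and ne: "underS \<Omega> \<gamma> \<noteq> {}"
    and limit: "\<And>\<alpha>. \<alpha> \<in> underS \<Omega> \<gamma> \<Longrightarrow> \<exists>\<beta> \<in> underS \<Omega> \<gamma>. \<alpha> \<noteq> \<beta> \<and> (\<alpha>, \<beta>) \<in> \<Omega>"
    and bound: "\<And>\<alpha>. \<alpha> \<in> underS \<Omega> \<gamma> \<Longrightarrow> \<nu> (\<Union>i \<in> underS \<Omega> \<alpha>. A i) \<le> v"
  shows "\<nu> (\<Union>i \<in> underS \<Omega> \<gamma>. A i) \<le> v"
proof -
  let ?s = "\<lambda>\<alpha>. (\<lambda>i. \<mu> (A i)) |` underS \<Omega> \<alpha>"
  have "underS \<Omega> \<gamma> \<subseteq> dom (\<lambda>i. \<mu> (A i))"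
    using A measurable_dom by blast
  \<comment> \<open>Sequences are partial maps, so the length is right only because every
    \<open>\<mu> (A i)\<close> is defined.\<close>
  then have dom: "dom (?s \<gamma>) = underS \<Omega> \<gamma>"
    by (simp add: Int_absorb1)
  \<comment> \<open>\<open>M4\<close> applies to every initial segment too. So all partial sums
    exist, as \<open>S2\<close> demands, and they are the measures of the partial unions.\<close>
  have sum: "?s \<alpha> \<in> dom Sum \<and> \<mu> (\<Union>i \<in> underS \<Omega> \<alpha>. A i) = Sum (?s \<alpha>)"
    if "\<alpha> \<in> underS \<Omega> \<gamma> \<or> \<alpha> = \<gamma>" for \<alpha>
  proof -
    have sub: "underS \<Omega> \<alpha> \<subseteq> underS \<Omega> \<gamma>" using that underS_underS_subset by blast
    show ?thesis
    proof (rule M4)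
      show "\<alpha> \<in> ords_below_cardSuc \<Omega> \<delta>" using that \<gamma> ords_below_downward by blast
      show "\<forall>i \<in> underS \<Omega> \<alpha>. A i \<in> M" using A sub by blast
      show "disjoint_family_on A (underS \<Omega> \<alpha>)" using disj sub by (rule disjoint_family_on_mono[rotated])
    qed
  qed
  have restr: "?s \<gamma> |` underS \<Omega> \<alpha> = ?s \<alpha>" if "\<alpha> \<in> underS \<Omega> \<gamma>" for \<alpha>
    using underS_underS_subset[OF that] by (simp add: Int_absorb1)
  have "isLub UNIV {the (Sum (?s \<gamma> |` underS \<Omega> \<alpha>)) |\<alpha>. \<alpha> \<in> dom (?s \<gamma>) \<and>
      ?s \<gamma> |` underS \<Omega> \<alpha> \<in> dom Sum} (the (Sum (?s \<gamma>)))"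
  proof (rule S2)
    show "?s \<gamma> \<in> dom Sum" using sum by blast
    show "dom (?s \<gamma>) \<noteq> {}" unfolding dom by (rule ne)
    show "\<forall>\<alpha> \<in> dom (?s \<gamma>). \<exists>\<beta> \<in> dom (?s \<gamma>). \<alpha> \<noteq> \<beta> \<and> (\<alpha>, \<beta>) \<in> \<Omega>"
      unfolding dom using limit by blast
    show "\<forall>\<alpha> \<in> dom (?s \<gamma>). \<exists>\<beta> \<in> dom (?s \<gamma>). (\<alpha>, \<beta>) \<in> \<Omega> \<and> ?s \<gamma> |` underS \<Omega> \<beta> \<in> dom Sum"
      unfolding dom using limit restr sum by metis
  qed
  moreover have "isUb UNIV {the (Sum (?s \<gamma> |` underS \<Omega> \<alpha>)) |\<alpha>. \<alpha> \<in> dom (?s \<gamma>) \<and>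
      ?s \<gamma> |` underS \<Omega> \<alpha> \<in> dom Sum} v"
    using bound sum restr unfolding dom isUb_def setle_def by fastforce
  ultimately have "the (Sum (?s \<gamma>)) \<le> v"
    by (rule isLub_le_isUb)
  then show ?thesis using sum[of \<gamma>] by simp
qed

text \<open>Induction on the length of the partial union: length zero gives measure 0, limits are
  covered by continuity of the sum, and only successors need the hypothesis
  \<open>step\<close>.\<close>

lemma nu_UN_le_Omega:
  assumes \<gamma>: "\<gamma> \<in> ords_below_cardSuc \<Omega> \<delta>" and A: "\<And>i. i \<in> underS \<Omega> \<gamma> \<Longrightarrow> A i \<in> M"
    and disj: "disjoint_family_on A (underS \<Omega> \<gamma>)"
    and step: "\<And>\<alpha>. \<alpha> \<in> underS \<Omega> \<gamma> \<Longrightarrow> \<nu> (\<Union>i \<in> underS \<Omega> \<alpha>. A i) \<le> v \<Longrightarrow>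
      \<nu> (A \<alpha> \<union> (\<Union>i \<in> underS \<Omega> \<alpha>. A i)) \<le> v"
  shows "\<nu> (\<Union>i \<in> underS \<Omega> \<gamma>. A i) \<le> v"
proof -
  have wo: "wo_rel \<Omega>" using well_order by (simp add: wo_rel_def)
  \<comment> \<open>The full length \<open>\<gamma>\<close> is included, so that the claim is itself
    an instance of the induction.\<close>
  have "\<beta> \<in> underS \<Omega> \<gamma> \<or> \<beta> = \<gamma> \<longrightarrow> \<nu> (\<Union>i \<in> underS \<Omega> \<beta>. A i) \<le> v" for \<beta>
  proof (induction \<beta> rule: wo_rel.well_order_induct[OF wo])
    case (1 \<beta>)
    show ?case
    proof
      assume \<beta>: "\<beta> \<in> underS \<Omega> \<gamma> \<or> \<beta> = \<gamma>"
      then have sub: "underS \<Omega> \<beta> \<subseteq> underS \<Omega> \<gamma>" using underS_underS_subset by blast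
      have IH: "\<nu> (\<Union>i \<in> underS \<Omega> \<alpha>. A i) \<le> v" if "\<alpha> \<in> underS \<Omega> \<beta>" for \<alpha>
        using 1 that sub by (auto simp: underS_def)
      show "\<nu> (\<Union>i \<in> underS \<Omega> \<beta>. A i) \<le> v"
      proof (cases "underS \<Omega> \<beta> = {}")
        case True
        then show ?thesis using M1 zero_minimum by simp
      next
        case ne: False
        show ?thesis
        proof (cases "\<forall>\<alpha> \<in> underS \<Omega> \<beta>. \<exists>\<alpha>' \<in> underS \<Omega> \<beta>. \<alpha> \<noteq> \<alpha>' \<and> (\<alpha>, \<alpha>') \<in> \<Omega>")
          case True
          show ?thesis
          proof (rule nu_limit_le)
            show "\<beta> \<in> ords_below_cardSuc \<Omega> \<delta>" using \<beta> \<gamma> ords_below_downward by blast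
            show "disjoint_family_on A (underS \<Omega> \<beta>)"
              using disj sub by (rule disjoint_family_on_mono[rotated])
          qed (use ne True IH A sub in blast)+
        next
          case False
          then obtain \<alpha> where \<alpha>: "\<alpha> \<in> underS \<Omega> \<beta>"
            and max: "\<forall>\<alpha>' \<in> underS \<Omega> \<beta>. \<alpha> = \<alpha>' \<or> (\<alpha>, \<alpha>') \<notin> \<Omega>" by blast
          \<comment> \<open>A largest index \<open>\<alpha>\<close> makes \<open>\<beta>\<close> its
            successor.\<close>
          have "\<alpha>' \<in> underS \<Omega> \<alpha>" if "\<alpha>' \<in> underS \<Omega> \<beta>" "\<alpha>' \<noteq> \<alpha>" for \<alpha>'
            using max that \<alpha> wo_rel.TOTALS[OF wo] by (fastforce simp: underS_def Field_def)
          then have "underS \<Omega> \<beta> = insert \<alpha> (underS \<Omega> \<alpha>)"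
            using \<alpha> underS_underS_subset[OF \<alpha>] by blast
          then show ?thesis
            using step[of \<alpha>] IH[OF \<alpha>] \<alpha> sub by auto
        qed
      qed
    qed
  qed
  then show ?thesis by blast
qed

text \<open>Transport of the induction to an arbitrary index order, applied below to the cardinal
  order of a family and to \<open>natLeq\<close>.\<close>

lemma nu_UN_le:
  assumes r: "Well_order r" and le: "r \<le>o \<delta>" and A: "\<And>a. a \<in> Field r \<Longrightarrow> A a \<in> M"
    and disj: "disjoint_family_on A (Field r)"
    and step: "\<And>a. a \<in> Field r \<Longrightarrow> \<nu> (\<Union>i \<in> underS r a. A i) \<le> v \<Longrightarrow>
      \<nu> (A a \<union> (\<Union>i \<in> underS r a. A i)) \<le> v"
  shows "\<nu> (\<Union>a \<in> Field r. A a) \<le> v"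
proof -
  obtain \<gamma> f where \<gamma>: "\<gamma> \<in> ords_below_cardSuc \<Omega> \<delta>"
    and b: "bij_betw f (Field r) (underS \<Omega> \<gamma>)"
    and u: "\<And>a. a \<in> Field r \<Longrightarrow> f ` underS r a = underS \<Omega> (f a)"
    using ord_representation[OF r le] by metis
  define g where "g = inv_into (Field r) f"
  have gf: "g (f a) = a" if "a \<in> Field r" for a
    using b that by (auto simp: g_def bij_betw_def)
  have gF: "g i \<in> Field r" "f (g i) = i" if "i \<in> underS \<Omega> \<gamma>" for i
    using b that unfolding g_def bij_betw_def by (auto simp: inv_into_into f_inv_into_f)
  have img: "g ` underS \<Omega> (f a) = underS r a" if "a \<in> Field r" for a
  proof -
    have "underS r a \<subseteq> Field r" by (auto simp: underS_def Field_def)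
    then show ?thesis using gf by (force simp: u[OF that, symmetric])
  qed
  have imgF: "g ` underS \<Omega> \<gamma> = Field r"
    using b bij_betw_inv_into[OF b] unfolding g_def bij_betw_def by blast
  have "\<nu> (\<Union>i \<in> underS \<Omega> \<gamma>. A (g i)) \<le> v"
  proof (rule nu_UN_le_Omega[OF \<gamma>])
    show "A (g i) \<in> M" if "i \<in> underS \<Omega> \<gamma>" for i
      using A gF that by blast
    show "disjoint_family_on (\<lambda>i. A (g i)) (underS \<Omega> \<gamma>)"
      using disj gF unfolding disjoint_family_on_def by metis
    fix \<alpha> assume \<alpha>: "\<alpha> \<in> underS \<Omega> \<gamma>" and "\<nu> (\<Union>i \<in> underS \<Omega> \<alpha>. A (g i)) \<le> v"
    moreover have "(\<Union>i \<in> underS \<Omega> \<alpha>. A (g i)) = (\<Union>i \<in> underS r (g \<alpha>). A i)"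
      using img[OF gF(1)[OF \<alpha>]] gF(2)[OF \<alpha>] by (metis image_image)
    ultimately show "\<nu> (A (g \<alpha>) \<union> (\<Union>i \<in> underS \<Omega> \<alpha>. A (g i))) \<le> v"
      using step[OF gF(1)[OF \<alpha>]] by simp
  qed
  moreover have "(\<Union>i \<in> underS \<Omega> \<gamma>. A (g i)) = (\<Union>a \<in> Field r. A a)"
    using imgF by (metis image_image)
  ultimately show ?thesis by simp
qed

text \<open>Enumerate \<open>F\<close> with \<open>A\<close> in front. If a partial union has
  measure at most \<open>\<nu> A\<close>, then adding \<open>B\<close> gives at most
  \<open>\<nu> A + \<nu> B = \<nu> (A \<union> B) \<le> \<nu> A\<close>, so the bound survives all
  successor steps, and limits come for free.\<close>

lemma nu_absorb_Union:
  assumes A: "A \<in> M" and F: "F \<subseteq> M" "|F| \<le>o \<delta>" "disjoint F"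
    and AF: "\<And>B. B \<in> F \<Longrightarrow> A \<inter> B = {}" and absorb: "\<And>B. B \<in> F \<Longrightarrow> \<nu> (A \<union> B) \<le> \<nu> A"
  shows "\<nu> (A \<union> \<Union>F) \<le> \<nu> A"
proof (cases "F = {}")
  case False
  let ?r = "|F|"
  have wo: "wo_rel ?r" by (simp add: wo_rel_def card_of_Well_order)
  \<comment> \<open>The first member of \<open>F\<close> in its cardinal order.\<close>
  define z where "z = wo_rel.minim ?r F"
  have z: "z \<in> F" and zmin: "\<And>B. B \<in> F \<Longrightarrow> (z, B) \<in> ?r"
    using wo_rel.minim_in[OF wo, of F] wo_rel.minim_least[OF wo, of F] False
    by (simp_all add: z_def Field_card_of)
  have uz: "underS ?r z = {}"
  proof (rule equals0I)
    fix B assume B: "B \<in> underS ?r z"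
    then have "B \<in> F" using FieldI1[of B z ?r] by (simp add: underS_def Field_card_of)
    then show False
      using B zmin wo_rel.ANTISYM[OF wo] by (auto simp: underS_def antisym_def)
  qed
  have uF: "underS ?r B \<subseteq> F" for B
    using Field_card_of[of F] by (auto simp: underS_def Field_def)
  \<comment> \<open>joining \<open>A\<close> to the first member of \<open>F\<close> puts \<open>A\<close> at the front of the sum\<close>
  define C where "C = (\<lambda>B. if B = z then A \<union> B else B)"
  have dis: "B \<inter> B' = {}" if "B \<in> F" "B' \<in> F" "B \<noteq> B'" for B B'
    using F(3) that by (auto simp: disjoint_def)
  have CM: "C B \<in> M" if "B \<in> F" for B
    using that A F measurable_Un by (auto simp: C_def)
  have "\<nu> (\<Union>B \<in> Field ?r. C B) \<le> \<nu> A"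
  proof (rule nu_UN_le[OF card_of_Well_order F(2)])
    show "C B \<in> M" if "B \<in> Field ?r" for B
      using that CM by (simp add: Field_card_of)
    have "C B \<inter> C B' = {}" if "B \<in> F" "B' \<in> F" "B \<noteq> B'" for B B'
      using dis[OF that] AF that by (auto simp: C_def)
    then show "disjoint_family_on C (Field ?r)"
      by (simp add: disjoint_family_on_def Field_card_of)
    fix B assume "B \<in> Field ?r" and bound: "\<nu> (\<Union>i \<in> underS ?r B. C i) \<le> \<nu> A"
    then have B: "B \<in> F" by (simp add: Field_card_of)
    let ?U = "\<Union>i \<in> underS ?r B. C i"
    show "\<nu> (C B \<union> ?U) \<le> \<nu> A"
    proof (cases "B = z")
      case True
      then show ?thesis using uz absorb[OF z] by (simp add: C_def)
    next
      case False
      have UM: "?U \<in> M"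
        using CM uF by (intro measurable_UN) (auto intro: ordLeq_transitive[OF card_of_mono1 F(2)])
      have "C i \<inter> B = {}" if i: "i \<in> underS ?r B" for i
      proof -
        have "i \<in> F" "i \<noteq> B" using i uF[of B] by (auto simp: underS_def)
        then have "i \<inter> B = {}" using dis B by blast
        then show ?thesis using AF[OF B] by (auto simp: C_def)
      qed
      then have "?U \<inter> B = {}" by blast
      then have "\<nu> (?U \<union> B) = \<nu> ?U + \<nu> B"
        using nu_Un[OF UM] B F by blast
      also have "\<dots> \<le> \<nu> A + \<nu> B"
        using bound by (simp add: plus_mono)
      also have "\<dots> = \<nu> (A \<union> B)"
        using nu_Un[OF A] B F AF by (metis subsetD)
      also have "\<dots> \<le> \<nu> A"
        using absorb[OF B] .
      finally show ?thesis
        using False by (simp add: C_def Un_commute)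
    qed
  qed
  moreover have "(\<Union>B \<in> Field ?r. C B) = A \<union> \<Union>F"
    using z by (auto simp: C_def Field_card_of split: if_splits)
  ultimately show ?thesis by simp
qed simp

section \<open>Sums of length \<open>\<omega>\<close>\<close>

lemma natLeq_ordLeq_delta: "natLeq \<le>o \<delta>"
  using infinite_card by (rule natLeq_ordLeq_cinfinite)

lemma nu_UN_nat_le:
  fixes A :: "nat \<Rightarrow> 'x set"
  assumes "\<And>n. A n \<in> M" and "disjoint_family A" and "\<And>n. \<nu> (\<Union>i<n. A i) \<le> v"
  shows "\<nu> (\<Union>n. A n) \<le> v"
proof -
  have u: "A n \<union> (\<Union>i \<in> underS natLeq n. A i) = (\<Union>i<Suc n. A i)" for n
    by (auto simp: natLeq_underS_less less_Suc_eq)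
  have "\<nu> (\<Union>n \<in> Field natLeq. A n) \<le> v"
    by (rule nu_UN_le[OF natLeq_Well_order natLeq_ordLeq_delta])
      (use assms in \<open>simp_all only: Field_natLeq u\<close>)
  then show ?thesis by (simp only: Field_natLeq)
qed

lemma measurable_UN_nat: "(\<And>n :: nat. A n \<in> M) \<Longrightarrow> (\<Union>n \<in> I. A n) \<in> M"
proof (rule measurable_UN)
  have "|I| \<le>o natLeq"
    using card_of_mono1[of I UNIV] card_of_nat ordLeq_ordIso_trans by blast
  then show "|I| \<le>o \<delta>"
    using natLeq_ordLeq_delta ordLeq_transitive by blast
qed

text \<open>Counting \<open>B\<close> first, each partial sum \<open>\<nu> B + \<nu> (A 0) + \<dots> + \<nu> (A (n - 1))\<close> is at most
  \<open>\<nu> (A 0) + \<dots> + \<nu> (A n)\<close>, so continuity of the sum at \<open>\<omega>\<close> makes \<open>B\<close> invisible.\<close>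

lemma nu_absorb_small:
  fixes A :: "nat \<Rightarrow> 'x set"
  assumes A: "\<And>n. A n \<in> M" and disj: "disjoint_family A" and B: "B \<in> M"
    and AB: "\<And>n. A n \<inter> B = {}" and small: "\<And>n. \<nu> B \<le> \<nu> (A n)"
  shows "\<nu> ((\<Union>n. A n) \<union> B) \<le> \<nu> (\<Union>n. A n)"
proof -
  define C where "C = (\<lambda>n. if n = 0 then A 0 \<union> B else A n)"
  have C: "C n \<in> M" for n
    using A B measurable_Un by (simp add: C_def)
  have dis: "A m \<inter> A n = {}" if "m \<noteq> n" for m n
    using disj that by (auto simp: disjoint_family_on_def)
  have "C m \<inter> C n = {}" if "m \<noteq> n" for m n
    using dis[OF that] AB[of m] AB[of n] that by (auto simp: C_def)
  then have "disjoint_family C"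
    by (simp add: disjoint_family_on_def)
  moreover have "\<nu> (\<Union>i<n. C i) \<le> \<nu> (\<Union>n. A n)" for n
  proof -
    let ?S = "\<Union>i<n. A i"
    have S: "?S \<in> M" using A by (rule measurable_UN_nat)
    \<comment> \<open>Only an inclusion of sets: for \<open>n = 0\<close> the left union is empty
      and misses \<open>B\<close>.\<close>
    have "\<nu> (\<Union>i<n. C i) \<le> \<nu> (?S \<union> B)"
    proof (rule M3)
      show "(\<Union>i<n. C i) \<in> M" using C by (rule measurable_UN_nat)
      show "?S \<union> B \<in> M" using S B by (rule measurable_Un)
    qed (auto simp: C_def split: if_splits)
    \<comment> \<open>Unions commute, so \<open>B\<close> can now be counted last, without
      commutativity of \<open>+\<close>. The next set \<open>A n\<close>, disjoint from
      \<open>?S\<close>, then takes its place.\<close>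
    also have "\<dots> = \<nu> ?S + \<nu> B"
      by (rule nu_Un) (use S B AB in auto)
    also have "\<dots> \<le> \<nu> ?S + \<nu> (A n)"
      using small by (simp add: plus_mono)
    also have "\<dots> = \<nu> (?S \<union> A n)"
    proof (rule nu_Un[symmetric])
      have "A i \<inter> A n = {}" if "i < n" for i
        using dis that by simp
      then show "?S \<inter> A n = {}" by blast
    qed (use S A in auto)
    also have "\<dots> \<le> \<nu> (\<Union>n. A n)"
      by (rule M3) (use S A measurable_UN_nat measurable_Un in auto)
    finally show ?thesis .
  qed
  ultimately have "\<nu> (\<Union>n. C n) \<le> \<nu> (\<Union>n. A n)"
    using C nu_UN_nat_le by blast
  moreover have "(\<Union>n. C n) = (\<Union>n. A n) \<union> B"
  proof
    show "(\<Union>n. C n) \<subseteq> (\<Union>n. A n) \<union> B"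
      by (auto simp: C_def split: if_splits)
    have "A n \<subseteq> C n" "B \<subseteq> C 0" for n
      by (auto simp: C_def)
    then show "(\<Union>n. A n) \<union> B \<subseteq> (\<Union>n. C n)" by blast
  qed
  ultimately show ?thesis by simp
qed

text \<open>By \<open>M5\<close> the infimum over the basis is \<open>\<nu> {x} = 0\<close>, so a
  positive \<open>e\<close> is not a lower bound.\<close>

lemma small_neighbourhood:
  assumes x: "x \<in> topspace X" "{x} \<in> M" "\<nu> {x} = 0"
    and basis: "open_local_basis X x \<B>" "|\<B>| \<le>o \<delta>" and e: "0 < e"
  shows "\<exists>V \<in> \<B>. \<nu> V < e"
proof (rule ccontr)
  assume "\<not> ?thesis"
  then have large: "e \<le> \<nu> V" if "V \<in> \<B>" for V
    using that by (meson not_less)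
  obtain \<gamma> f where \<gamma>: "\<gamma> \<in> ords_below_cardSuc \<Omega> \<delta>" and f: "bij_betw f \<B> (underS \<Omega> \<gamma>)"
    by (rule ord_representation[OF card_of_Well_order basis(2)]) (simp only: Field_card_of)
  let ?g = "inv_into \<B> f"
  have g: "?g ` underS \<Omega> \<gamma> = \<B>"
    using bij_betw_inv_into[OF f] by (simp add: bij_betw_def)
  have "isGlb UNIV ((\<lambda>i. \<nu> (?g i)) ` underS \<Omega> \<gamma>) (\<nu> {x})"
    by (rule M5[OF x(1,2) \<gamma>]) (simp add: g basis)
  moreover have "isLb UNIV ((\<lambda>i. \<nu> (?g i)) ` underS \<Omega> \<gamma>) e"
    using large g by (auto simp: isLb_def setge_def)
  ultimately have "e \<le> \<nu> {x}"
    by (rule isGlb_le_isLb)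
  then show False using x(3) e by simp
qed

end

section \<open>The bounded topology\<close>

locale bounded_space =
  fixes \<kappa> :: "'i rel" and L :: "'a set"
  assumes wo: "Well_order \<kappa>" and Field_nonempty: "Field \<kappa> \<noteq> {}"
begin

text \<open>Naming a cone by a point and a level turns comparison of the cones around a point into
  comparison of levels.\<close>

definition nbhd :: "('i \<rightharpoonup> 'a) \<Rightarrow> 'i \<Rightarrow> ('i \<rightharpoonup> 'a) set" where
  "nbhd x \<alpha> = cone \<kappa> L (x |` underS \<kappa> \<alpha>)"

lemma wo_rel_kappa: "wo_rel \<kappa>"
  using wo by (simp add: wo_rel_def)

lemma total: "\<alpha> \<in> Field \<kappa> \<Longrightarrow> \<beta> \<in> Field \<kappa> \<Longrightarrow> (\<alpha>, \<beta>) \<in> \<kappa> \<or> (\<beta>, \<alpha>) \<in> \<kappa>"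
  using wo_rel.TOTALS[OF wo_rel_kappa] by blast

lemma underS_mono: "(\<alpha>, \<beta>) \<in> \<kappa> \<Longrightarrow> underS \<kappa> \<alpha> \<subseteq> underS \<kappa> \<beta>"
  using wo_rel.TRANS[OF wo_rel_kappa] wo_rel.ANTISYM[OF wo_rel_kappa]
  unfolding underS_def trans_def antisym_def by blast

lemma underS_subset_Field: "underS \<kappa> \<alpha> \<subseteq> Field \<kappa>"
  by (auto simp: underS_def Field_def)

lemma mem_nbhd:
  assumes "x \<in> full_seqs \<kappa> L"
  shows "z \<in> nbhd x \<alpha> \<longleftrightarrow> z \<in> full_seqs \<kappa> L \<and> (\<forall>i \<in> underS \<kappa> \<alpha>. z i = x i)"
proof -
  have "dom (x |` underS \<kappa> \<alpha>) = underS \<kappa> \<alpha>"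
    using assms underS_subset_Field[of \<alpha>] by (auto simp: full_seqs_def)
  then show ?thesis
    by (auto simp: nbhd_def cone_def map_le_def)
qed

lemma nbhd_subset: "nbhd x \<alpha> \<subseteq> full_seqs \<kappa> L"
  by (auto simp: nbhd_def cone_def)

lemma nbhd_self: "x \<in> full_seqs \<kappa> L \<Longrightarrow> x \<in> nbhd x \<alpha>"
  by (simp add: mem_nbhd)

lemma nbhd_mono: "x \<in> full_seqs \<kappa> L \<Longrightarrow> (\<alpha>, \<beta>) \<in> \<kappa> \<Longrightarrow> nbhd x \<beta> \<subseteq> nbhd x \<alpha>"
  using underS_mono[of \<alpha> \<beta>] by (simp add: mem_nbhd subset_iff)

text \<open>The ultrametric property: every point of a ball is a centre of it.\<close>

lemma nbhd_eq: "x \<in> full_seqs \<kappa> L \<Longrightarrow> z \<in> nbhd x \<alpha> \<Longrightarrow> nbhd z \<alpha> = nbhd x \<alpha>"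
  by (auto simp: mem_nbhd)

section \<open>Cones as a base of the topology\<close>

lemma nbhd_in_cones:
  assumes "x \<in> full_seqs \<kappa> L" and "\<alpha> \<in> Field \<kappa>"
  shows "nbhd x \<alpha> \<in> cone \<kappa> L ` seqs_below \<kappa> L"
proof -
  have "dom (x |` underS \<kappa> \<alpha>) = underS \<kappa> \<alpha>"
    using assms underS_subset_Field[of \<alpha>] by (auto simp: full_seqs_def)
  moreover have "ran (x |` underS \<kappa> \<alpha>) \<subseteq> L"
    using assms(1) by (auto simp: full_seqs_def ran_def restrict_map_def split: if_splits)
  ultimately show ?thesis
    using assms(2) unfolding nbhd_def seqs_below_def by blast
qed

lemma openin_nbhd:
  "x \<in> full_seqs \<kappa> L \<Longrightarrow> \<alpha> \<in> Field \<kappa> \<Longrightarrow> openin (bounded_topology \<kappa> L) (nbhd x \<alpha>)"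
  unfolding bounded_topology_def by (intro topology_generated_by_Basis nbhd_in_cones)

lemma cone_eq_nbhd:
  assumes "s \<in> seqs_below \<kappa> L" and x: "x \<in> cone \<kappa> L s"
  obtains \<alpha> where "\<alpha> \<in> Field \<kappa>" and "cone \<kappa> L s = nbhd x \<alpha>"
proof -
  obtain \<alpha> where \<alpha>: "\<alpha> \<in> Field \<kappa>" "dom s = underS \<kappa> \<alpha>"
    using assms(1) by (auto simp: seqs_below_def)
  have "x |` underS \<kappa> \<alpha> = s"
  proof
    fix i show "(x |` underS \<kappa> \<alpha>) i = s i"
    proof (cases "i \<in> dom s")
      case True
      then show ?thesis using x \<alpha>(2) by (simp add: cone_def map_le_def)
    next
      case False
      then have "i \<notin> underS \<kappa> \<alpha>" "s i = None" using \<alpha>(2) by auto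
      then show ?thesis by simp
    qed
  qed
  then show thesis using that[OF \<alpha>(1)] by (simp add: nbhd_def)
qed

text \<open>The cones, given as a subbase, already form a base: those around one point are nested,
  so the intersection of two of them is the smaller one.\<close>

lemma openin_bounded_topology:
  "openin (bounded_topology \<kappa> L) U \<longleftrightarrow>
    U \<subseteq> full_seqs \<kappa> L \<and> (\<forall>x \<in> U. \<exists>\<alpha> \<in> Field \<kappa>. nbhd x \<alpha> \<subseteq> U)" (is "_ \<longleftrightarrow> ?N U")
proof
  assume "openin (bounded_topology \<kappa> L) U"
  then have "generate_topology_on (cone \<kappa> L ` seqs_below \<kappa> L) U"
    by (simp add: bounded_topology_def openin_topology_generated_by_iff)
  then show "?N U"
  proof induction
    case (Int U V)
    have "\<exists>\<alpha> \<in> Field \<kappa>. nbhd x \<alpha> \<subseteq> U \<inter> V" if x: "x \<in> U \<inter> V" for x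
    proof -
      have xF: "x \<in> full_seqs \<kappa> L" using Int x by blast
      obtain \<alpha> \<beta> where \<alpha>: "\<alpha> \<in> Field \<kappa>" "nbhd x \<alpha> \<subseteq> U" and \<beta>: "\<beta> \<in> Field \<kappa>" "nbhd x \<beta> \<subseteq> V"
        using Int x by blast
      show ?thesis
        using total[OF \<alpha>(1) \<beta>(1)] \<alpha> \<beta> nbhd_mono[OF xF] by (meson Int_greatest subset_trans)
    qed
    then show ?case using Int by blast
  next
    case (UN K)
    show ?case
    proof (intro conjI ballI)
      show "\<Union>K \<subseteq> full_seqs \<kappa> L" using UN by blast
      fix x assume "x \<in> \<Union>K"
      then obtain U where "U \<in> K" "x \<in> U" by blast
      then show "\<exists>\<alpha> \<in> Field \<kappa>. nbhd x \<alpha> \<subseteq> \<Union>K" using UN by (meson Union_upper subset_trans)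
    qed
  next
    case (Basis U)
    then obtain s where s: "s \<in> seqs_below \<kappa> L" "U = cone \<kappa> L s" by blast
    moreover have "\<exists>\<alpha> \<in> Field \<kappa>. nbhd x \<alpha> \<subseteq> U" if "x \<in> U" for x
      using cone_eq_nbhd[OF s(1), of x] that s(2) by (metis order_refl)
    ultimately show ?case by (auto simp: cone_def)
  qed simp
next
  assume N: "?N U"
  have "\<exists>V. openin (bounded_topology \<kappa> L) V \<and> x \<in> V \<and> V \<subseteq> U" if x: "x \<in> U" for x
  proof -
    have xF: "x \<in> full_seqs \<kappa> L" using N x by blast
    obtain \<alpha> where \<alpha>: "\<alpha> \<in> Field \<kappa>" "nbhd x \<alpha> \<subseteq> U" using N x by blast
    show ?thesis using openin_nbhd[OF xF \<alpha>(1)] \<alpha>(2) nbhd_self[OF xF] by blast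
  qed
  then show "openin (bounded_topology \<kappa> L) U"
    by (subst openin_subopen) blast
qed

lemma topspace_bounded_topology: "topspace (bounded_topology \<kappa> L) = full_seqs \<kappa> L"
proof
  show "topspace (bounded_topology \<kappa> L) \<subseteq> full_seqs \<kappa> L"
    using openin_topspace openin_bounded_topology by blast
  have "openin (bounded_topology \<kappa> L) (full_seqs \<kappa> L)"
    using Field_nonempty nbhd_subset by (auto simp: openin_bounded_topology)
  then show "full_seqs \<kappa> L \<subseteq> topspace (bounded_topology \<kappa> L)"
    by (rule openin_subset)
qed

lemma open_local_basis_nbhds:
  assumes "x \<in> full_seqs \<kappa> L"
  shows "open_local_basis (bounded_topology \<kappa> L) x (nbhd x ` Field \<kappa>)"
  unfolding open_local_basis_def
proof (intro conjI ballI allI impI)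
  fix V assume "V \<in> nbhd x ` Field \<kappa>"
  then show "openin (bounded_topology \<kappa> L) V" "x \<in> V"
    using openin_nbhd[OF assms] nbhd_self[OF assms] by auto
next
  fix U assume "openin (bounded_topology \<kappa> L) U \<and> x \<in> U"
  then show "\<exists>V \<in> nbhd x ` Field \<kappa>. V \<subseteq> U"
    by (simp add: openin_bounded_topology)
qed

text \<open>Taking the largest cone with property \<open>Q\<close> around each point gives a partition.\<close>

lemma cone_partition:
  assumes C: "C \<subseteq> full_seqs \<kappa> L"
    and Q: "\<And>y. y \<in> C \<Longrightarrow> \<exists>\<alpha> \<in> Field \<kappa>. nbhd y \<alpha> \<subseteq> C \<and> Q (nbhd y \<alpha>)"
  obtains F where "F \<subseteq> cone \<kappa> L ` seqs_below \<kappa> L" and "disjoint F" and "\<Union>F = C"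
    and "\<And>B. B \<in> F \<Longrightarrow> Q B"
proof -
  define P where "P = (\<lambda>y \<alpha>. \<alpha> \<in> Field \<kappa> \<and> nbhd y \<alpha> \<subseteq> C \<and> Q (nbhd y \<alpha>))"
  define m where "m = (\<lambda>y. wo_rel.minim \<kappa> {\<alpha>. P y \<alpha>})"
  have sub: "{\<alpha>. P y \<alpha>} \<subseteq> Field \<kappa>" for y
    by (auto simp: P_def)
  have m: "P y (m y)" if "y \<in> C" for y
    using wo_rel.minim_in[OF wo_rel_kappa sub[of y]] Q[OF that] by (auto simp: m_def P_def)
  have least: "(m y, \<alpha>) \<in> \<kappa>" if "P y \<alpha>" for y \<alpha>
    using wo_rel.minim_least[OF wo_rel_kappa sub[of y]] that by (simp add: m_def)
  have meet: "nbhd y (m y) = nbhd z (m z)"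
    if y: "y \<in> C" and z: "z \<in> C" and u: "u \<in> nbhd y (m y)" "u \<in> nbhd z (m z)"
      and le: "(m y, m z) \<in> \<kappa>" for y z u
  proof -
    have full: "y \<in> full_seqs \<kappa> L" "z \<in> full_seqs \<kappa> L" using y z C by auto
    \<comment> \<open>The common point \<open>u\<close> is a centre of both cones at the lower level
      \<open>m y\<close>. Hence \<open>m y\<close> is admissible for \<open>z\<close> as well, and
      minimality of \<open>m z\<close> makes the two levels equal.\<close>
    have eq: "nbhd z (m y) = nbhd y (m y)"
      using nbhd_eq[OF full(1) u(1)] nbhd_eq[OF full(2), of u "m y"] nbhd_mono[OF full(2) le] u(2)
      by blast
    then have "P z (m y)" using m[OF y] by (simp add: P_def)
    then have "(m z, m y) \<in> \<kappa>" by (rule least)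
    then have "m z = m y"
      using le wo_rel.ANTISYM[OF wo_rel_kappa] by (meson antisymD)
    then show ?thesis using eq by simp
  qed
  show thesis
  proof
    show "(\<lambda>y. nbhd y (m y)) ` C \<subseteq> cone \<kappa> L ` seqs_below \<kappa> L"
      using nbhd_in_cones C m by (fastforce simp: P_def)
    show "disjoint ((\<lambda>y. nbhd y (m y)) ` C)"
    proof (rule disjointI)
      fix V W assume "V \<in> (\<lambda>y. nbhd y (m y)) ` C" "W \<in> (\<lambda>y. nbhd y (m y)) ` C" and ne: "V \<noteq> W"
      then obtain y z where y: "y \<in> C" "V = nbhd y (m y)" and z: "z \<in> C" "W = nbhd z (m z)"
        by blast
      have "m y \<in> Field \<kappa>" "m z \<in> Field \<kappa>"
        using m y z by (auto simp: P_def)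
      then show "V \<inter> W = {}"
        using total[of "m y" "m z"] meet[of y z] meet[of z y] y z ne by blast
    qed
    show "\<Union>((\<lambda>y. nbhd y (m y)) ` C) = C"
      using m C nbhd_self unfolding P_def by blast
    show "Q B" if "B \<in> (\<lambda>y. nbhd y (m y)) ` C" for B
      using that m by (auto simp: P_def)
  qed
qed

end

section \<open>Cardinality of the length\<close>

text \<open>A countable set of indices is too small to be cofinal in a regular uncountable
  cardinal.\<close>

lemma uncountable_regular_bound:
  fixes a :: "nat \<Rightarrow> 'i"
  assumes \<kappa>: "Card_order \<kappa>" "regularCard \<kappa>" "natLeq <o \<kappa>" and a: "\<And>n. a n \<in> Field \<kappa>"
  obtains w where "w \<in> Field \<kappa>" and "\<And>n. (a n, w) \<in> \<kappa>"
proof -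
  have "|range a| \<le>o natLeq"
    using card_of_image card_of_nat ordLeq_ordIso_trans by blast
  then have "\<not> |range a| =o \<kappa>"
    using \<kappa>(3) by (meson not_ordLess_ordIso ordLeq_ordLess_trans)
  then have "\<not> cofinal (range a) \<kappa>"
    using \<kappa>(2) a unfolding regularCard_def by (metis image_subsetI)
  then obtain w where w: "w \<in> Field \<kappa>" "\<And>n. w = a n \<or> (w, a n) \<notin> \<kappa>"
    by (auto simp: cofinal_def)
  have "wo_rel \<kappa>"
    using \<kappa>(1) by (simp add: wo_rel_def card_order_on_well_order_on)
  then have "(a n, w) \<in> \<kappa>" for n
    using w a wo_rel.TOTALS by metis
  then show thesis using that w(1) by blast
qed

text \<open>A map on \<open>insert d D\<close> is a map on \<open>D\<close> updated at
  \<open>d\<close>, and an infinite \<open>L\<close> absorbs the product with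
  \<open>L\<close>.\<close>

lemma card_maps_finite_dom:
  assumes "finite D" and L: "infinite L"
  shows "|{s. dom s = D \<and> ran s \<subseteq> L}| \<le>o |L|"
  using \<open>finite D\<close>
proof (induction D rule: finite_induct)
  case empty
  have "{s. dom s = {} \<and> ran s \<subseteq> L} = {Map.empty}" by auto
  then show ?case using L by (metis card_of_singl_ordLeq finite.emptyI)
next
  case (insert d D)
  let ?T = "{s. dom s = D \<and> ran s \<subseteq> L}"
  have "{s. dom s = insert d D \<and> ran s \<subseteq> L} \<subseteq> (\<lambda>(s, v). s(d \<mapsto> v)) ` (?T \<times> L)"
  proof
    fix s assume s: "s \<in> {s. dom s = insert d D \<and> ran s \<subseteq> L}"
    then obtain v where v: "s d = Some v" by auto
    then have "v \<in> L" using s by (auto simp: ran_def)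
    moreover have "s |` D \<in> ?T"
      using s insert.hyps by (auto simp: ran_def restrict_map_def split: if_splits)
    moreover have "s = (s |` D)(d \<mapsto> v)"
    proof
      fix i show "s i = ((s |` D)(d \<mapsto> v)) i"
        using s v by (cases "i \<in> dom s") (auto simp: restrict_map_def)
    qed
    ultimately show "s \<in> (\<lambda>(s, v). s(d \<mapsto> v)) ` (?T \<times> L)"
      by (intro image_eqI[of _ _ "(s |` D, v)"]) auto
  qed
  then have "|{s. dom s = insert d D \<and> ran s \<subseteq> L}| \<le>o |?T \<times> L|"
    by (rule surj_imp_ordLeq)
  also have "|?T \<times> L| \<le>o |L|"
    by (rule card_of_Times_ordLeq_infinite_Field)
      (simp_all only: Field_card_of L insert.IH card_of_card_order_on card_of_mono1 order_refl
        not_False_eq_True)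
  finally show ?case .
qed

text \<open>If \<open>\<kappa>\<close> were countable, all lengths below it would be finite. Each
  would contribute at most \<open>lam\<close> sequences, and there are at most \<open>lam\<close>
  lengths, so \<open>seqs_below\<close> would have size at most \<open>lam\<close>.\<close>

lemma uncountable_length:
  assumes \<kappa>: "Cinfinite \<kappa>" and lam: "Cinfinite lam" and le: "\<kappa> \<le>o lam"
    and less: "lam <o |seqs_below \<kappa> (Field lam)|"
  shows "natLeq <o \<kappa>"
proof (rule ccontr)
  have wo: "Well_order \<kappa>"
    using conjunct2[OF \<kappa>] by (rule card_order_on_well_order_on)
  assume "\<not> natLeq <o \<kappa>"
  then have count: "\<kappa> \<le>o natLeq"
    by (rule not_ordLess_iff_ordLeq[OF wo natLeq_Well_order, THEN iffD1])
  let ?L = "Field lam"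
  have L: "infinite ?L" using lam by (simp add: cinfinite_def)
  have FL: "|?L| =o lam" using lam card_of_Field_ordIso by blast
  have F\<kappa>: "|Field \<kappa>| \<le>o |?L|" using le by (rule card_of_mono2)
  have fin: "finite (underS \<kappa> \<alpha>)" if \<alpha>: "\<alpha> \<in> Field \<kappa>" for \<alpha>
  proof -
    have "|underS \<kappa> \<alpha>| <o \<kappa>" using \<kappa> \<alpha> by (simp add: card_of_underS)
    then have "|underS \<kappa> \<alpha>| <o natLeq" using count by (rule ordLess_ordLeq_trans)
    then show ?thesis by (simp add: finite_iff_ordLess_natLeq)
  qed
  have "|\<Union>\<alpha> \<in> Field \<kappa>. {s. dom s = underS \<kappa> \<alpha> \<and> ran s \<subseteq> ?L}| \<le>o |?L|"
    by (rule card_of_UNION_ordLeq_infinite[OF L F\<kappa>]) (use card_maps_finite_dom[OF fin L] in simp)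
  moreover have "(\<Union>\<alpha> \<in> Field \<kappa>. {s. dom s = underS \<kappa> \<alpha> \<and> ran s \<subseteq> ?L}) = seqs_below \<kappa> ?L"
    by (auto simp: seqs_below_def)
  ultimately have "|seqs_below \<kappa> ?L| \<le>o lam"
    using ordLeq_ordIso_trans[OF _ FL] by simp
  then show False using less not_ordLess_ordLeq by blast
qed

section \<open>Non-existence\<close>

text \<open>The bound by \<open>\<delta>\<close> on the number of sequences bounds every family of
  cones, so partitions into cones and local bases of cones are within reach of \<open>M4\<close> and
  \<open>M5\<close>.\<close>

lemma no_continuous_measure_uncountable:
  assumes \<kappa>: "Cinfinite \<kappa>" "regularCard \<kappa>" "natLeq <o \<kappa>"
    and \<delta>: "|seqs_below \<kappa> L| \<le>o \<delta>"
    and measure: "weak_measure_space \<delta> \<Omega> S (bounded_topology \<kappa> L) M \<mu>"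
    and cont: "continuous_measure (bounded_topology \<kappa> L) M \<mu>"
  shows False
proof -
  interpret weak_measure_space \<delta> \<Omega> S "bounded_topology \<kappa> L" M \<mu>
    by (rule measure)
  interpret bounded_space \<kappa> L
  proof
    show "Well_order \<kappa>" using conjunct2[OF \<kappa>(1)] by (rule card_order_on_well_order_on)
    show "Field \<kappa> \<noteq> {}" using \<kappa>(1) by (auto simp: cinfinite_def)
  qed
  let ?X = "full_seqs \<kappa> L"
  have nbhd_M: "nbhd y \<alpha> \<in> M" if "y \<in> ?X" "\<alpha> \<in> Field \<kappa>" for y \<alpha>
    using open_sets openin_nbhd[OF that] .
  have X_M: "?X \<in> M"
    using open_sets[OF openin_topspace] by (simp add: topspace_bounded_topology)
  have cones_le: "|F| \<le>o \<delta>" if "F \<subseteq> cone \<kappa> L ` seqs_below \<kappa> L" for F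
    using surj_imp_ordLeq[OF that] \<delta> ordLeq_transitive by blast
  have cones_M: "cone \<kappa> L ` seqs_below \<kappa> L \<subseteq> M"
    by (auto simp: bounded_topology_def intro!: open_sets topology_generated_by_Basis)
  have small: "\<exists>\<alpha> \<in> Field \<kappa>. \<nu> (nbhd y \<alpha>) < e" if y: "y \<in> ?X" and e: "0 < e" for y e
  proof -
    have "\<exists>V \<in> nbhd y ` Field \<kappa>. \<nu> V < e"
    proof (rule small_neighbourhood)
      show "y \<in> topspace (bounded_topology \<kappa> L)"
        using y by (simp add: topspace_bounded_topology)
      then show "{y} \<in> M" "\<nu> {y} = 0"
        using cont by (auto simp: continuous_measure_def)
      show "open_local_basis (bounded_topology \<kappa> L) y (nbhd y ` Field \<kappa>)"
        using y by (rule open_local_basis_nbhds)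
      show "|nbhd y ` Field \<kappa>| \<le>o \<delta>"
        using y nbhd_in_cones by (intro cones_le) blast
    qed (rule e)
    then show ?thesis by blast
  qed
  \<comment> \<open>Used twice: with \<open>A\<close> empty and \<open>e = 0\<close> to find the
    point \<open>x\<close>, and with the union of the sets \<open>A n\<close> for the final
    contradiction.\<close>
  have absorb_cover: "\<nu> (A \<union> C) \<le> \<nu> A"
    if A: "A \<in> M" and C: "C \<subseteq> ?X" "A \<inter> C = {}"
      and cover: "\<And>y. y \<in> C \<Longrightarrow> \<exists>\<alpha> \<in> Field \<kappa>. nbhd y \<alpha> \<subseteq> C \<and> \<nu> (nbhd y \<alpha>) \<le> e"
      and absorb: "\<And>B. B \<in> M \<Longrightarrow> A \<inter> B = {} \<Longrightarrow> \<nu> B \<le> e \<Longrightarrow> \<nu> (A \<union> B) \<le> \<nu> A" for A C e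
  proof -
    obtain F where F: "F \<subseteq> cone \<kappa> L ` seqs_below \<kappa> L" "disjoint F" "\<Union>F = C"
      and Fe: "\<And>B. B \<in> F \<Longrightarrow> \<nu> B \<le> e"
      using cone_partition[OF C(1) cover] by metis
    have FM: "F \<subseteq> M" using F(1) cones_M by blast
    have AF: "A \<inter> B = {}" if "B \<in> F" for B
      using C(2) F(3) that by blast
    have "\<nu> (A \<union> \<Union>F) \<le> \<nu> A"
      using nu_absorb_Union[OF A FM cones_le[OF F(1)] F(2) AF] absorb FM AF Fe by blast
    then show ?thesis by (simp add: F(3))
  qed
  have "\<exists>x \<in> ?X. \<forall>\<alpha> \<in> Field \<kappa>. 0 < \<nu> (nbhd x \<alpha>)"
  proof (rule ccontr)
    assume "\<not> ?thesis"
    then have null: "\<exists>\<alpha> \<in> Field \<kappa>. nbhd y \<alpha> \<subseteq> ?X \<and> \<nu> (nbhd y \<alpha>) \<le> 0" if "y \<in> ?X" for y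
      using that nbhd_subset by (meson not_le)
    have "\<nu> ({} \<union> ?X) \<le> \<nu> {}"
      by (rule absorb_cover[where e = 0]) (use null M1 empty_measurable in auto)
    then show False
      using M1 M2 by (simp add: topspace_bounded_topology leD)
  qed
  then obtain x where x: "x \<in> ?X" and pos: "\<And>\<alpha>. \<alpha> \<in> Field \<kappa> \<Longrightarrow> 0 < \<nu> (nbhd x \<alpha>)"
    by blast
  obtain a0 where a0: "a0 \<in> Field \<kappa>" "\<nu> (nbhd x a0) < \<nu> ?X"
    using small[OF x] M2 by (auto simp: topspace_bounded_topology)
  \<comment> \<open>Such a \<open>\<beta>\<close> exists because
    \<open>\<nu> (nbhd x \<alpha>)\<close> is positive and can be taken as the bound in
    \<open>small\<close>.\<close>
  define next_index where "next_index = (\<lambda>\<alpha>. SOME \<beta>. \<beta> \<in> Field \<kappa> \<and> \<nu> (nbhd x \<beta>) < \<nu> (nbhd x \<alpha>))"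
  have next_index: "next_index \<alpha> \<in> Field \<kappa>" "\<nu> (nbhd x (next_index \<alpha>)) < \<nu> (nbhd x \<alpha>)"
    if "\<alpha> \<in> Field \<kappa>" for \<alpha>
    using someI_ex[OF small[OF x pos[OF that], unfolded Bex_def]]
    unfolding next_index_def by blast+
  define a where "a = (\<lambda>n. (next_index ^^ n) a0)"
  have a: "a n \<in> Field \<kappa>" for n
    by (induction n) (simp_all add: a_def a0(1) next_index(1))
  have decr: "\<nu> (nbhd x (a (Suc n))) < \<nu> (nbhd x (a n))" for n
    using next_index(2)[OF a[of n]] by (simp add: a_def)
  let ?D = "\<lambda>n. nbhd x (a n)"
  \<comment> \<open>The measures strictly decrease, so by monotonicity the levels cannot go
    down.\<close>
  have step: "(a n, a (Suc n)) \<in> \<kappa>" for n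
    using total[OF a a, of n "Suc n"] nbhd_mono[OF x, of "a (Suc n)" "a n"]
      M3[OF nbhd_M[OF x a] nbhd_M[OF x a], of n "Suc n"] decr[of n] by (meson leD)
  have "?D (Suc n) \<subseteq> ?D n" for n
    using nbhd_mono[OF x step] .
  then have anti: "?D n \<subseteq> ?D m" if "m \<le> n" for m n
    using lift_Suc_antimono_le[of ?D] that by blast
  define A where "A = (\<lambda>n. ?D n - ?D (Suc n))"
  \<comment> \<open>Membership in \<open>A n\<close> is decided at level \<open>a (Suc n)\<close>.
    This makes \<open>A n\<close> open and, later, the complement of the union open.\<close>
  have A_local: "nbhd y (a (Suc n)) \<subseteq> A n" if y: "y \<in> A n" for y n
  proof
    fix z assume z: "z \<in> nbhd y (a (Suc n))"
    have yD: "y \<in> ?D n" "y \<notin> ?D (Suc n)" using y by (auto simp: A_def)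
    then have yX: "y \<in> ?X" using nbhd_subset by blast
    have zX: "z \<in> ?X" using z nbhd_subset by blast
    have "z \<in> ?D n"
      using z nbhd_mono[OF yX step] nbhd_eq[OF x yD(1)] by blast
    moreover have "z \<notin> ?D (Suc n)"
      using nbhd_eq[OF yX z] nbhd_eq[OF x] nbhd_self[OF yX] yD(2) by blast
    ultimately show "z \<in> A n" by (simp add: A_def)
  qed
  have A_X: "A n \<subseteq> ?X" for n
    using nbhd_subset[of x "a n"] by (auto simp: A_def)
  have "openin (bounded_topology \<kappa> L) (A n)" for n
    unfolding openin_bounded_topology using A_X A_local a by blast
  then have A_M: "A n \<in> M" for n
    using open_sets by blast
  have A_disj: "A m \<inter> A n = {}" if "m < n" for m n
    using anti[of "Suc m" n] that by (auto simp: A_def)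
  have "disjoint_family A"
    unfolding disjoint_family_on_def using A_disj by (metis Int_commute linorder_neqE_nat)
  have A_pos: "0 < \<nu> (A n)" for n
  proof (rule ccontr)
    assume "\<not> 0 < \<nu> (A n)"
    then have "\<nu> (A n) = 0"
      using zero_minimum by (meson antisym not_le)
    moreover have "A n \<union> ?D (Suc n) = ?D n"
      using anti[of n "Suc n"] by (auto simp: A_def)
    ultimately have "\<nu> (?D n) = \<nu> (?D (Suc n))"
      using nu_Un[OF A_M nbhd_M[OF x a], of n "Suc n"] by (auto simp: A_def)
    then show False using decr[of n] by simp
  qed
  \<comment> \<open>A level \<open>v\<close> above all \<open>b n\<close> yields one cone around
    \<open>x\<close>, still of positive measure \<open>e\<close>, that is at most as large as each
    \<open>A n\<close>.\<close>
  obtain b where b: "\<And>n. b n \<in> Field \<kappa>" "\<And>n. \<nu> (nbhd x (b n)) < \<nu> (A n)"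
    using small[OF x A_pos] by metis
  obtain v where v: "v \<in> Field \<kappa>" "\<And>n. (b n, v) \<in> \<kappa>"
    using uncountable_regular_bound[of \<kappa> b] \<kappa> b(1) by blast
  \<comment> \<open>At level \<open>w\<close> membership in all the \<open>A n\<close> is decided
    simultaneously.\<close>
  obtain w where w: "w \<in> Field \<kappa>" "\<And>n. (a n, w) \<in> \<kappa>"
    using uncountable_regular_bound[of \<kappa> a] \<kappa> a by blast
  define e where "e = \<nu> (nbhd x v)"
  have e_pos: "0 < e" using pos[OF v(1)] by (simp add: e_def)
  have e_le: "e \<le> \<nu> (A n)" for n
    using M3[OF nbhd_M[OF x v(1)] nbhd_M[OF x b(1)] nbhd_mono[OF x v(2)], of n] b(2)[of n]
    by (simp add: e_def)
  let ?A = "\<Union>n. A n"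
  have UA_M: "?A \<in> M" using A_M by (rule measurable_UN_nat)
  have "\<nu> (?A \<union> (?X - ?A)) \<le> \<nu> ?A"
  proof (rule absorb_cover[OF UA_M, where e = e])
    fix y assume y: "y \<in> ?X - ?A"
    then have yX: "y \<in> ?X" by blast
    have yw: "nbhd y w \<subseteq> ?X - ?A"
    proof
      fix z assume z: "z \<in> nbhd y w"
      then have zX: "z \<in> ?X" using nbhd_subset by blast
      \<comment> \<open>Otherwise the cone around \<open>z\<close> at level \<open>w\<close>, which
        contains \<open>y\<close>, would lie inside \<open>A n\<close>.\<close>
      have "z \<notin> A n" for n
        using A_local[of z n] nbhd_mono[OF zX w(2)] nbhd_eq[OF yX z] nbhd_self[OF yX] y by blast
      then show "z \<in> ?X - ?A" using zX by blast
    qed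
    obtain \<beta> where \<beta>: "\<beta> \<in> Field \<kappa>" "\<nu> (nbhd y \<beta>) < e"
      using small[OF yX e_pos] by blast
    \<comment> \<open>The larger of \<open>w\<close> and \<open>\<beta>\<close> works:
      \<open>w\<close> keeps the cone off \<open>?A\<close>, \<open>\<beta>\<close> keeps it
      small.\<close>
    show "\<exists>\<alpha> \<in> Field \<kappa>. nbhd y \<alpha> \<subseteq> ?X - ?A \<and> \<nu> (nbhd y \<alpha>) \<le> e"
    proof (cases "(w, \<beta>) \<in> \<kappa>")
      case True
      then show ?thesis using \<beta> yw nbhd_mono[OF yX True] by (meson less_imp_le subset_trans)
    next
      case False
      then have "nbhd y w \<subseteq> nbhd y \<beta>"
        using total[OF w(1) \<beta>(1)] nbhd_mono[OF yX] by blast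
      then have "\<nu> (nbhd y w) \<le> \<nu> (nbhd y \<beta>)"
        using M3 nbhd_M[OF yX] w(1) \<beta>(1) by blast
      then show ?thesis using w(1) yw \<beta>(2) by (meson less_imp_le order_trans)
    qed
  next
    fix B assume B: "B \<in> M" "?A \<inter> B = {}" "\<nu> B \<le> e"
    show "\<nu> (?A \<union> B) \<le> \<nu> ?A"
      by (rule nu_absorb_small[OF A_M \<open>disjoint_family A\<close> B(1)])
        (use B e_le order_trans in blast)+
  qed auto
  then have "\<nu> ?X \<le> \<nu> ?A"
    using UN_least[of UNIV A ?X] A_X by (simp add: Un_absorb1)
  \<comment> \<open>\<open>?D 0\<close> is the cone at level \<open>a0\<close>, chosen to be
    strictly smaller in measure than the whole space.\<close>
  also have "\<dots> \<le> \<nu> (?D 0)"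
  proof (rule M3[OF UA_M nbhd_M[OF x a]])
    have "A n \<subseteq> ?D 0" for n
      using anti[of 0 n] by (auto simp: A_def)
    then show "?A \<subseteq> ?D 0" by blast
  qed
  finally show False
    using a0(2) by (simp add: a_def)
qed

theorem corollary8p2:
  fixes \<kappa> :: "'k rel" and lam :: "'l rel" and \<delta> :: "('k \<rightharpoonup> 'l) rel" and \<Omega> :: "'o rel"
    and Sum :: "('o \<rightharpoonup> 's::pos_tot_ordered_monoid) \<rightharpoonup> 's"
  assumes "Cinfinite \<kappa>" and "Cinfinite lam" and "\<kappa> \<le>o lam" and "regularCard \<kappa>"
    and "\<delta> = |seqs_below \<kappa> (Field lam)|"
    and "lam <o \<delta>"
    and "Well_order \<Omega>" and "cardSuc \<delta> \<le>o \<Omega>"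
    and "infinitary_sum \<Omega> Sum"
  shows "\<not> (\<exists>M \<mu>. weak_measure_space \<delta> \<Omega> Sum (bounded_topology \<kappa> (Field lam)) M \<mu> \<and>
                   continuous_measure (bounded_topology \<kappa> (Field lam)) M \<mu>)"
proof -
  have "natLeq <o \<kappa>"
    using uncountable_length[OF assms(1-3)] assms(5,6) by simp
  moreover have "|seqs_below \<kappa> (Field lam)| \<le>o \<delta>"
    unfolding assms(5) by (rule ordIso_imp_ordLeq[OF card_of_refl])
  ultimately show ?thesis
    using no_continuous_measure_uncountable[OF assms(1,4)] by blast
qed

end
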